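(* Let $x\in\mathbb{R}$. The identity $$\sum_{s=0}^{\infty}\Phi_{2s+1}(x)\,y^{s}=\frac{1}{\sqrt{y+1}}\sinh\left(x\sqrt{y+1}\right)$$ holds for all $y\in\mathbb{C}$.
   Context: For an integer $s\ge 0$, $$\Phi_{2s+1}(x):=\frac{1}{2\pi i}\int_{\Gamma_r}\frac{e^{xz}}{(z-1)^{s+1}(z+1)^{s+1}}\,dz,$$ where $\Gamma_r(t)=re^{it}$, $t\in[0,2\pi]$, $r>1$. Since $\sinh(w)/w$ is an even entire function of $w$, the right-hand side does not depend on the choice of the square root and is an entire function of $y$; at $y=-1$ it is understood as its limit value $x$. *)

theory Defs
  imports "HOL-Complex_Analysis.Complex_Analysis"
begin

text \<open>
  \<open>Phi_odd r s x\<close> is \<open>\<Phi>\<^bsub>2s+1\<^esub>(x)\<close>: the second argument is \<open>s\<close>, not the index \<open>2s+1\<close>.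
  The radius of the contour is a parameter; only radii \<open>r > 1\<close> are meant.
\<close>

definition Phi_odd :: "real \<Rightarrow> nat \<Rightarrow> real \<Rightarrow> complex" where
  "Phi_odd r s x =
     1 / (2 * complex_of_real pi * \<i>) *
     contour_integral (circlepath 0 r)
       (\<lambda>z. exp (complex_of_real x * z) / ((z - 1) ^ (s + 1) * (z + 1) ^ (s + 1)))"

definition sinh_sqrt_quot :: "real \<Rightarrow> complex \<Rightarrow> complex" where
  "sinh_sqrt_quot x y =
     (if y = -1 then complex_of_real x
      else 1 / csqrt (y + 1) * sinh (complex_of_real x * csqrt (y + 1)))"

text \<open>The choice of the square root is immaterial.\<close>

lemma sinh_sqrt_quot_any_root:
  assumes "w ^ 2 = y + 1" "y \<noteq> -1"
  shows "sinh_sqrt_quot x y = 1 / w * sinh (complex_of_real x * w)"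
proof -
  have "w ^ 2 = csqrt (y + 1) ^ 2"
    using assms(1) by simp
  hence "w = csqrt (y + 1) \<or> w = - csqrt (y + 1)"
    by (simp only: power2_eq_iff)
  thus ?thesis
    using assms(2) by (auto simp: sinh_sqrt_quot_def)
qed

text \<open>The exceptional value is the limit value.\<close>

lemma sinh_sqrt_quot_tendsto: "sinh_sqrt_quot x \<midarrow>-1\<rightarrow> complex_of_real x"
proof -
  define f where "f = (\<lambda>w. sinh (complex_of_real x * w))"
  have "(f has_field_derivative complex_of_real x) (at 0)"
    unfolding f_def by (auto intro!: derivative_eq_intros)
  hence lim: "(\<lambda>w. f w / w) \<midarrow>0\<rightarrow> complex_of_real x"
    by (simp add: has_field_derivative_iff f_def)
  have "((\<lambda>y. csqrt (y + 1)) \<longlongrightarrow> 0) (at (-1))"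
  proof (rule tendsto_norm_zero_cancel)
    have "((\<lambda>y::complex. sqrt (norm (y + 1))) \<longlongrightarrow> sqrt (norm (-1 + 1 :: complex))) (at (-1))"
      by (intro tendsto_intros)
    thus "((\<lambda>y. norm (csqrt (y + 1))) \<longlongrightarrow> 0) (at (-1))"
      by (simp add: norm_csqrt)
  qed
  moreover have ev: "\<forall>\<^sub>F y in at (-1). y + 1 \<noteq> (0::complex)"
    by (auto simp: eventually_at_filter add_eq_0_iff2)
  ultimately have "filterlim (\<lambda>y. csqrt (y + 1)) (at 0) (at (-1))"
    by (auto simp: filterlim_at)
  from filterlim_compose[OF lim this]
  have "((\<lambda>y. f (csqrt (y + 1)) / csqrt (y + 1)) \<longlongrightarrow> complex_of_real x) (at (-1))" .
  thus ?thesis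
    by (rule Lim_transform_eventually)
       (use ev in eventually_elim, auto simp: sinh_sqrt_quot_def f_def)
qed

end

theory Submission
  imports Defs
begin

text \<open>
  Enlarging the contour does not change the integrals, since the integrands are holomorphic
  outside the unit disc. On a circle with \<open>\<bar>z\<^sup>2 - 1\<bar> > \<bar>y\<bar>\<close> the geometric series
  may be summed under the integral sign, which leaves \<open>e\<^bsup>xz\<^esup> / (z\<^sup>2 - (y + 1))\<close>;
  this is integrated by Cauchy's formula.
\<close>

text \<open>The straight-line homotopy joins points of equal angle, so it moves radially: every
  intermediate point has distance from \<open>c\<close> equal to a convex combination of
  \<open>r\<close> and \<open>R\<close>, which stays above \<open>a\<close>.\<close>

lemma contour_integral_circlepath_radius:
  assumes f: "f holomorphic_on {z. norm (z - c) > a}" and "a \<ge> 0" "r > a" "R > a"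
  shows "contour_integral (circlepath c r) f = contour_integral (circlepath c R) f"
proof (rule Cauchy_theorem_homotopic_loops[OF _ _ f])
  show "homotopic_loops {z. norm (z - c) > a} (circlepath c r) (circlepath c R)"
  proof (rule homotopic_loops_linear, safe)
    fix t :: real and z
    assume "z \<in> closed_segment (circlepath c r t) (circlepath c R t)"
    then obtain u where u: "0 \<le> u" "u \<le> 1"
      and z: "z = (1 - u) *\<^sub>R circlepath c r t + u *\<^sub>R circlepath c R t"
      by (auto simp: closed_segment_def)
    have "z - c = complex_of_real ((1 - u) * r + u * R) * exp (2 * of_real pi * \<i> * of_real t)"
      unfolding z circlepath by (simp add: scaleR_conv_of_real algebra_simps)
    hence "norm (z - c) = \<bar>(1 - u) * r + u * R\<bar>"
      by (simp only: norm_mult norm_of_real) (simp add: norm_exp_eq_Re)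
    moreover have "(1 - u) * r + u * R > a"
      \<comment> \<open>\<open>convex_bound_lt\<close> bounds a convex combination from above;
        negating everything turns this into the lower bound.\<close>
      using u assms convex_bound_lt[of "- r" "- a" "- R" "1 - u" u] by simp
    ultimately show "norm (z - c) > a"
      by linarith
  qed auto
  show "open {z. norm (z - c) > a}"
    by (intro open_Collect_less continuous_intros)
qed auto

text \<open>The only poles, 1 and -1, lie on the unit circle. This frees the radius to depend on
  \<open>y\<close> later on.\<close>

lemma Phi_odd_radius:
  assumes "r > 1" "R > 1"
  shows "Phi_odd r s x = Phi_odd R s x"
proof -
  have "(\<lambda>z. exp (complex_of_real x * z) / ((z - 1) ^ (s + 1) * (z + 1) ^ (s + 1)))
          holomorphic_on {z. norm (z - 0) > 1}"
    by (intro holomorphic_intros) (auto simp: add_eq_0_iff2)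
  from contour_integral_circlepath_radius[OF this _ assms] show ?thesis
    by (simp add: Phi_odd_def)
qed

text \<open>Partial fractions split the integrand into two simple poles \<open>w\<close> and
  \<open>- w\<close>, both inside the circle; the values of the exponential there combine to a
  hyperbolic sine.\<close>

lemma contour_integral_exp_over_square_diff:
  fixes x w :: complex
  assumes "norm w < R" "w \<noteq> 0"
  shows "((\<lambda>z. exp (x * z) / (z ^ 2 - w ^ 2)) has_contour_integral
           (2 * of_real pi * \<i> * (sinh (x * w) / w))) (circlepath 0 R)"
proof -
  have cauchy: "((\<lambda>z. exp (x * z) / (z - v)) has_contour_integral (2 * of_real pi * \<i> * exp (x * v)))
                  (circlepath 0 R)" if "norm v < R" for v
    using that by (intro Cauchy_integral_circlepath_simple holomorphic_intros) auto
  \<comment> \<open>The form \<open>z - - w\<close> lets \<open>cauchy\<close> apply with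
    \<open>v = - w\<close>.\<close>
  have "((\<lambda>z. 1 / (2 * w) * (exp (x * z) / (z - w) - exp (x * z) / (z - - w)))
          has_contour_integral
          1 / (2 * w) * (2 * of_real pi * \<i> * exp (x * w) - 2 * of_real pi * \<i> * exp (x * - w)))
          (circlepath 0 R)"
    using assms
    by (intro has_contour_integral_lmul has_contour_integral_diff cauchy) auto
  moreover have "1 / (2 * w) * (2 * of_real pi * \<i> * exp (x * w) - 2 * of_real pi * \<i> * exp (x * - w))
                  = 2 * of_real pi * \<i> * (sinh (x * w) / w)"
    by (simp add: sinh_field_def field_simps)
  ultimately have "((\<lambda>z. 1 / (2 * w) * (exp (x * z) / (z - w) - exp (x * z) / (z - - w)))
          has_contour_integral 2 * of_real pi * \<i> * (sinh (x * w) / w)) (circlepath 0 R)"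
    by (simp only:)
  thus ?thesis
  proof (rule has_contour_integral_eq)
    fix z assume "z \<in> path_image (circlepath 0 R)"
    hence "norm z = R"
      using assms by (auto simp: path_image_circlepath dest: le_less_trans[OF norm_ge_zero])
    hence "z \<noteq> w" "z \<noteq> - w"
      using assms by auto
    hence "z - w \<noteq> 0" "z + w \<noteq> 0"
      by (auto simp: add_eq_0_iff2)
    moreover have "z ^ 2 - w ^ 2 = (z - w) * (z + w)"
      by (simp add: power2_eq_square algebra_simps)
    ultimately show "1 / (2 * w) * (exp (x * z) / (z - w) - exp (x * z) / (z - - w))
                       = exp (x * z) / (z ^ 2 - w ^ 2)"
      using assms by (simp add: divide_simps) (simp add: algebra_simps)
  qed
qed

text \<open>The degenerate case \<open>w = 0\<close>: the two poles merge into a double pole, and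
  Cauchy's formula for the first derivative yields \<open>x\<close>, the limit value of the
  quotient.\<close>

lemma contour_integral_exp_over_square:
  fixes x :: complex
  assumes "R > 0"
  shows "((\<lambda>z. exp (x * z) / z ^ 2) has_contour_integral (2 * of_real pi * \<i> * x)) (circlepath 0 R)"
proof -
  have "((\<lambda>z. exp (x * z) / (z - 0) ^ Suc 1) has_contour_integral
          (2 * pi * \<i>) / fact 1 * (deriv ^^ 1) (\<lambda>z. exp (x * z)) 0) (circlepath 0 R)"
    using assms
    by (intro Cauchy_has_contour_integral_higher_derivative_circlepath
          holomorphic_intros continuous_intros) auto
  moreover have "deriv (\<lambda>z. exp (x * z)) 0 = x"
    by (rule DERIV_imp_deriv) (auto intro!: derivative_eq_intros)
  ultimately show ?thesis
    by (simp add: numeral_2_eq_2)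
qed

text \<open>The poles are the square roots of \<open>y + 1\<close>; the bound on
  \<open>norm (y + 1)\<close> places them inside the circle.\<close>

lemma contour_integral_exp_resolvent:
  assumes "R > 0" "norm (y + 1) < R ^ 2"
  shows "contour_integral (circlepath 0 R) (\<lambda>z. exp (complex_of_real x * z) / (z ^ 2 - 1 - y))
           = 2 * of_real pi * \<i> * sinh_sqrt_quot x y"
proof (cases "y = -1")
  case True
  thus ?thesis
    using contour_integral_unique[OF contour_integral_exp_over_square[OF assms(1), of "of_real x"]]
    by (simp add: sinh_sqrt_quot_def)
next
  case False
  define w where "w = csqrt (y + 1)"
  have w2: "w ^ 2 = y + 1"
    by (simp add: w_def)
  have "norm w ^ 2 < R ^ 2"
    using assms(2) by (simp flip: norm_power add: w2)
  hence "norm w < R"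
    using assms(1) by (rule power2_less_imp_less[OF _ less_imp_le])
  moreover have "w \<noteq> 0"
    using False w2 by (auto simp: add_eq_0_iff2)
  ultimately have "contour_integral (circlepath 0 R) (\<lambda>z. exp (of_real x * z) / (z ^ 2 - w ^ 2))
                    = 2 * of_real pi * \<i> * (sinh (of_real x * w) / w)"
    by (intro contour_integral_unique contour_integral_exp_over_square_diff)
  thus ?thesis
    using False by (simp add: sinh_sqrt_quot_def w2 flip: w_def) (simp add: algebra_simps)
qed

lemma Phi_odd_sums_large_radius:
  assumes R: "R > 1" "R ^ 2 - 1 > norm y"
  shows "(\<lambda>s. Phi_odd R s x * y ^ s) sums sinh_sqrt_quot x y"
proof -
  let ?C = "circlepath 0 R"
  define F where "F = (\<lambda>s z. exp (complex_of_real x * z) / ((z - 1) ^ (s + 1) * (z + 1) ^ (s + 1)))"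
  define G where "G = (\<lambda>z. exp (complex_of_real x * z) / (z ^ 2 - 1 - y))"
  \<comment> \<open>\<open>M * q ^ s\<close> is the majorant of the series on the circle, obtained
    from \<open>lower\<close>.\<close>
  define M where "M = exp (\<bar>x\<bar> * R) / (R ^ 2 - 1)"
  define q where "q = norm y / (R ^ 2 - 1)"
  have R2: "R ^ 2 - 1 > 0"
    using R(2) norm_ge_zero[of y] by linarith
  hence q: "0 \<le> q" "q < 1"
    using R by (auto simp: q_def)
  \<comment> \<open>Since \<open>(z - 1) * (z + 1) = z ^ 2 - 1\<close>, the terms form a geometric
    series of ratio \<open>y / (z ^ 2 - 1)\<close>.\<close>
  have F_eq: "F s z * y ^ s = exp (complex_of_real x * z) / (z ^ 2 - 1) * (y / (z ^ 2 - 1)) ^ s"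
    for s z
  proof -
    have "(z - 1) ^ (s + 1) * (z + 1) ^ (s + 1) = (z ^ 2 - 1) ^ (s + 1)"
      by (simp only: power_mult_distrib[symmetric]) (simp add: power2_eq_square algebra_simps)
    thus ?thesis
      by (simp add: F_def power_divide)
  qed
  have lower: "norm (z ^ 2 - 1) \<ge> R ^ 2 - 1" if "z \<in> sphere 0 R" for z :: complex
    using norm_triangle_ineq2[of "z ^ 2" 1] that by (simp add: norm_power)
  have bound: "norm (F s z * y ^ s) \<le> M * q ^ s" if z: "z \<in> sphere 0 R" for s z
  proof -
    have "norm (exp (complex_of_real x * z)) \<le> exp (\<bar>x\<bar> * R)"
      using norm_exp[of "complex_of_real x * z"] z by (simp add: norm_mult)
    thus ?thesis
      unfolding F_eq M_def q_def norm_mult norm_divide norm_power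
      using R2 lower[OF z] by (intro mult_mono frac_le power_mono divide_nonneg_nonneg) auto
  qed
  have sums_G: "(\<lambda>s. F s z * y ^ s) sums G z" if z: "z \<in> sphere 0 R" for z
  proof -
    have z0: "norm (z ^ 2 - 1) > norm y"
      using lower[OF z] R by linarith
    hence "norm (y / (z ^ 2 - 1)) < 1"
      by (auto simp: norm_divide divide_less_eq_1)
    from sums_mult[OF geometric_sums[OF this], of "exp (complex_of_real x * z) / (z ^ 2 - 1)"]
    have "(\<lambda>s. F s z * y ^ s) sums
            (exp (complex_of_real x * z) / (z ^ 2 - 1) * (1 / (1 - y / (z ^ 2 - 1))))"
      unfolding F_eq .
    moreover have "z ^ 2 - 1 \<noteq> 0" "z ^ 2 - 1 - y \<noteq> 0"
      using z0 by auto
    hence "exp (complex_of_real x * z) / (z ^ 2 - 1) * (1 / (1 - y / (z ^ 2 - 1))) = G z"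
      unfolding G_def by (simp add: divide_simps)
    ultimately show ?thesis
      by simp
  qed
  have F_int: "(\<lambda>z. F s z * y ^ s) contour_integrable_on ?C" for s
  proof (rule contour_integrable_continuous_circlepath)
    have "z ^ 2 - 1 \<noteq> 0" if "z \<in> sphere 0 R" for z :: complex
      using lower[OF that] R2 by auto
    thus "continuous_on (path_image ?C) (\<lambda>z. F s z * y ^ s)"
      unfolding F_eq using R by (auto intro!: continuous_intros)
  qed
  \<comment> \<open>Uniform convergence is what permits exchanging sum and integral; the limit is
    then identified pointwise with \<open>G\<close>.\<close>
  have "uniform_limit (sphere 0 R) (\<lambda>n z. \<Sum>s<n. F s z * y ^ s) (\<lambda>z. \<Sum>s. F s z * y ^ s) sequentially"
    using q bound
    by (intro Weierstrass_m_test[where M = "\<lambda>s. M * q ^ s"] summable_mult summable_geometric) auto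
  also have "?this \<longleftrightarrow> uniform_limit (sphere 0 R) (\<lambda>n z. \<Sum>s<n. F s z * y ^ s) G sequentially"
    by (intro uniform_limit_cong' refl sums_unique[symmetric] sums_G)
  finally have "(\<lambda>n. contour_integral ?C (\<lambda>z. \<Sum>s<n. F s z * y ^ s)) \<longlonglongrightarrow> contour_integral ?C G"
    using R by (intro contour_integral_uniform_limit_circlepath)
                 (auto intro!: always_eventually contour_integrable_sum F_int)
  hence "(\<lambda>s. contour_integral ?C (\<lambda>z. F s z * y ^ s)) sums contour_integral ?C G"
    by (simp add: sums_def contour_integral_sum F_int)
  from sums_mult[OF this, of "1 / (2 * complex_of_real pi * \<i>)"]
  have "(\<lambda>s. 1 / (2 * complex_of_real pi * \<i>) * contour_integral ?C (\<lambda>z. F s z * y ^ s))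
          sums (1 / (2 * complex_of_real pi * \<i>) * contour_integral ?C G)" .
  \<comment> \<open>Integrability of \<open>F s\<close> itself is recovered from
    \<open>F_int\<close> by dividing by \<open>y ^ s\<close>. If that power vanishes, both sides are
    0.\<close>
  moreover have "contour_integral ?C (\<lambda>z. F s z * y ^ s) = contour_integral ?C (F s) * y ^ s" for s
  proof (cases "y ^ s = 0")
    case False
    thus ?thesis
      using contour_integral_rmul[of "\<lambda>z. F s z" ?C "y ^ s"]
            contour_integrable_rmul[OF F_int[of s], of "1 / y ^ s"] by simp
  next
    case True
    show ?thesis
      unfolding True using contour_integral_unique[OF has_contour_integral_0] by simp
  qed
  moreover have "norm (y + 1) < R ^ 2"
    using norm_triangle_ineq[of y 1] R by simp
  hence "contour_integral ?C G = 2 * of_real pi * \<i> * sinh_sqrt_quot x y"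
    unfolding G_def using R by (intro contour_integral_exp_resolvent) auto
  ultimately show ?thesis
    by (simp add: Phi_odd_def F_def mult_ac)
qed

theorem theorem16:
  fixes x r :: real and y :: complex
  assumes "r > 1"
  shows "(\<lambda>s. Phi_odd r s x * y ^ s) sums sinh_sqrt_quot x y"
proof -
  \<comment> \<open>With this choice \<open>R ^ 2 - 1 = norm y ^ 2 + 4 * norm y + 3\<close>, which
    exceeds \<open>norm y\<close>.\<close>
  define R where "R = norm y + 2"
  have "R > 1" "R ^ 2 - 1 > norm y"
    using norm_ge_zero[of y] by (simp_all add: R_def power2_eq_square algebra_simps add_pos_nonneg)
  from Phi_odd_sums_large_radius[OF this] show ?thesis
    using Phi_odd_radius[OF assms \<open>R > 1\<close>] by simp
qed

end
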